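(* Let $X$ denote a $(\theta,\tau)$ GMSI process on $[0,\Delta)$. Assume that $t\ge0$, $u\ge s\ge0$, and $t+u+s<\Delta$, and let $R_s(t)=X(t+s)-X(t)$. Then $$\mathrm{Cor}(R_s(t),R_s(t+u))=\frac{-s\tau}{\theta-s\tau}\quad\text{and}\quad \mathrm{Cor}(R_s^2(t),R_s^2(t+u))=\frac{s^2\tau^2}{(\theta-s\tau)^2},$$ as the result of which $$\lim_{\tau\to-\infty}\mathrm{Cor}(R_s(t),R_s(t+u))=1,\qquad \lim_{\substack{\tau\to\theta/\Delta\\ s\to\Delta/2}}\mathrm{Cor}(R_s(t),R_s(t+u))=-1,$$ and $$\big(\mathrm{Cor}(R_s(t),R_s(t+u))\big)^2\le \mathrm{Cor}(R_s^2(t),R_s^2(t+u))\le\big|\mathrm{Cor}(R_s(t),R_s(t+u))\big| .$$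
   Context: A $(\theta,\tau)$ GMSI process on $[0,\Delta)$ (where $0<\Delta\le\infty$, $\theta>0$, $\tau\le\theta/\Delta$, with $\theta/\infty=0$) is a real, continuous, zero-mean Gaussian Markov process $X$ with $X(0)=0$, stationary increments, and covariance $E[X(s)X(t)]=s(\theta-\tau t)$ for $0\le s\le t<\Delta$. For random variables $X,Y$, $\mathrm{Cor}(X,Y)=\mathrm{Cov}(X,Y)/(\sqrt{\mathrm{Var}\,X}\sqrt{\mathrm{Var}\,Y})$.
   Formalization: The limit −1 is stated only for finite Δ (for Δ=∞ the correlation lies in [0,1) for all admissible τ, so it cannot tend to −1), and the limit 1 as τ→−∞ only for s>0 (at s=0 the correlation is undefined). *)

theory Defs
  imports "HOL-Probability.Probability"
begin

definition covariance :: "'a measure \<Rightarrow> ('a \<Rightarrow> real) \<Rightarrow> ('a \<Rightarrow> real) \<Rightarrow> real" where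
  "covariance M Y Z =
     (\<integral>\<omega>. (Y \<omega> - (\<integral>\<omega>. Y \<omega> \<partial>M)) * (Z \<omega> - (\<integral>\<omega>. Z \<omega> \<partial>M)) \<partial>M)"

text \<open>If one of the variances vanishes, the correlation is \<open>0\<close>, as division by \<open>0\<close> yields \<open>0\<close>.\<close>

definition correlation :: "'a measure \<Rightarrow> ('a \<Rightarrow> real) \<Rightarrow> ('a \<Rightarrow> real) \<Rightarrow> real" where
  "correlation M Y Z =
     covariance M Y Z / (sqrt (covariance M Y Y) * sqrt (covariance M Z Z))"

text \<open>Point masses count as (degenerate) normal distributions.\<close>

definition normal_law :: "real measure \<Rightarrow> bool" where
  "normal_law N \<longleftrightarrow>
     (\<exists>\<mu>. N = return borel \<mu>) \<or>
     (\<exists>\<mu> \<sigma>. \<sigma> > 0 \<and> N = density lborel (\<lambda>x. ennreal (normal_density \<mu> \<sigma> x)))"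

text \<open>All finite-dimensional distributions are multivariate normal, i.e. all linear combinations
  of finitely many \<open>X t\<close> are normal.\<close>

definition gaussian_process :: "'a measure \<Rightarrow> real set \<Rightarrow> (real \<Rightarrow> 'a \<Rightarrow> real) \<Rightarrow> bool" where
  "gaussian_process M T X \<longleftrightarrow>
     (\<forall>t\<in>T. X t \<in> borel_measurable M) \<and>
     (\<forall>J c. finite J \<longrightarrow> J \<subseteq> T \<longrightarrow>
        normal_law (distr M borel (\<lambda>\<omega>. \<Sum>t\<in>J. c t * X t \<omega>)))"

definition generated_algebra ::
    "'a measure \<Rightarrow> (real \<Rightarrow> 'a \<Rightarrow> real) \<Rightarrow> real set \<Rightarrow> 'a measure" where
  "generated_algebra M X S =
     sigma (space M) {X r -` B \<inter> space M | r B. r \<in> S \<and> B \<in> sets borel}"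

text \<open>The conditional probability of \<open>X t \<in> B\<close> given the past up to time \<open>s \<le> t\<close> coincides
  with that given \<open>X s\<close>.\<close>

definition markov_process :: "'a measure \<Rightarrow> real set \<Rightarrow> (real \<Rightarrow> 'a \<Rightarrow> real) \<Rightarrow> bool" where
  "markov_process M T X \<longleftrightarrow>
     (\<forall>t\<in>T. X t \<in> borel_measurable M) \<and>
     (\<forall>s\<in>T. \<forall>t\<in>T. s \<le> t \<longrightarrow> (\<forall>B\<in>sets borel.
        AE \<omega> in M.
          real_cond_exp M (generated_algebra M X {r\<in>T. r \<le> s}) (\<lambda>\<omega>. indicator B (X t \<omega>)) \<omega> =
          real_cond_exp M (generated_algebra M X {s}) (\<lambda>\<omega>. indicator B (X t \<omega>)) \<omega>))"

definition increment :: "(real \<Rightarrow> 'a \<Rightarrow> real) \<Rightarrow> real \<Rightarrow> real \<Rightarrow> 'a \<Rightarrow> real" where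
  "increment X s t = (\<lambda>\<omega>. X (t + s) \<omega> - X t \<omega>)"

definition stationary_increments :: "'a measure \<Rightarrow> real set \<Rightarrow> (real \<Rightarrow> 'a \<Rightarrow> real) \<Rightarrow> bool" where
  "stationary_increments M T X \<longleftrightarrow>
     (\<forall>h\<ge>0. \<forall>t t'. t \<in> T \<longrightarrow> t + h \<in> T \<longrightarrow> t' \<in> T \<longrightarrow> t' + h \<in> T \<longrightarrow>
        distr M borel (increment X h t) = distr M borel (increment X h t'))"

text \<open>The interval \<open>[0, \<Delta>)\<close>, where \<open>\<Delta> = \<infinity>\<close> is possible. For extended reals,
  \<open>\<theta> / \<infinity> = 0\<close>.\<close>

definition time_interval :: "ereal \<Rightarrow> real set" where
  "time_interval \<Delta> = {t. 0 \<le> t \<and> ereal t < \<Delta>}"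

locale gmsi_process = prob_space M
  for M :: "'a measure" and X :: "real \<Rightarrow> 'a \<Rightarrow> real"
    and \<theta> \<tau> :: real and \<Delta> :: ereal +
  assumes Delta_pos: "0 < \<Delta>"
    and theta_pos: "0 < \<theta>"
    and tau_le: "ereal \<tau> \<le> ereal \<theta> / \<Delta>"
    and continuous: "AE \<omega> in M. continuous_on (time_interval \<Delta>) (\<lambda>t. X t \<omega>)"
    and gaussian: "gaussian_process M (time_interval \<Delta>) X"
    and markov: "markov_process M (time_interval \<Delta>) X"
    and stationary: "stationary_increments M (time_interval \<Delta>) X"
    and starts_at_0: "AE \<omega> in M. X 0 \<omega> = 0"
    and zero_mean: "\<And>t. t \<in> time_interval \<Delta> \<Longrightarrow> expectation (X t) = 0"
    and cov: "\<And>s t. 0 \<le> s \<Longrightarrow> s \<le> t \<Longrightarrow> ereal t < \<Delta> \<Longrightarrow>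
                expectation (\<lambda>\<omega>. X s \<omega> * X t \<omega>) = s * (\<theta> - \<tau> * t)"

text \<open>The joint limit \<open>\<tau> \<rightarrow> \<theta> / D\<close>, \<open>s \<rightarrow> D / 2\<close> for a finite end point \<open>D\<close>, taken over all
  admissible \<open>(\<tau>, s, t, u)\<close> and uniformly in \<open>t\<close> and \<open>u\<close>. These cannot be kept fixed in
  general: the constraints force \<open>t \<rightarrow> 0\<close> and \<open>u \<rightarrow> D / 2\<close>.\<close>

definition joint_limit :: "real \<Rightarrow> real \<Rightarrow> (real \<times> real \<times> real \<times> real) filter" where
  "joint_limit \<theta> D =
     inf (filtercomap (\<lambda>(\<tau>, s, t, u). (\<tau>, s)) (nhds (\<theta> / D, D / 2)))
         (principal {(\<tau>, s, t, u). \<tau> \<le> \<theta> / D \<and> 0 \<le> t \<and> 0 \<le> s \<and> s \<le> u \<and> t + u + s < D})"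

end

theory Submission
  imports Defs "HOL-Real_Asymp.Real_Asymp"
begin

text \<open>With \<open>v\<close> the common variance of the two increments and \<open>c\<close> their covariance, the covariance
  function gives \<open>v = s (\<theta> - s \<tau>)\<close> and \<open>c = - s\<^sup>2 \<tau>\<close>. For squares, polarization reduces
  \<open>E[Y\<^sup>2 Z\<^sup>2]\<close> to fourth moments of the Gaussian variables \<open>Y\<close>, \<open>Z\<close>, \<open>Y + Z\<close> and \<open>Y - Z\<close>, so
  \<open>Cov(Y\<^sup>2, Z\<^sup>2) = 2 c\<^sup>2\<close> and the correlation of the squares is the square of the correlation.\<close>

section \<open>Moments and correlations of centred Gaussian pairs\<close>

context prob_space
begin

text \<open>All moments are computed on the law of \<open>W\<close>, where centring leaves two
  cases: the point mass at 0, for which the fourth-moment identity reads 0 = 0, and a normal density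
  with mean 0. The value of \<open>k\<close> stays free because orders 1, 2 and 4 are needed
  later.\<close>

lemma normal_law_centered_moments:
  assumes [measurable]: "W \<in> borel_measurable M"
    and law: "normal_law (distr M borel W)" and mean: "expectation W = 0"
  shows "integrable M (\<lambda>\<omega>. W \<omega> ^ k)"
    and "expectation (\<lambda>\<omega>. W \<omega> ^ 4) = 3 * (expectation (\<lambda>\<omega>. (W \<omega>)\<^sup>2))\<^sup>2"
proof -
  have mean': "(\<integral>x. x \<partial>distr M borel W) = 0"
    using mean by (simp add: integral_distr)
  have int_iff: "integrable M (\<lambda>\<omega>. W \<omega> ^ k) \<longleftrightarrow> integrable (distr M borel W) (\<lambda>x. x ^ k)" for k
    by (simp add: integrable_distr_eq)
  have expect_eq: "expectation (\<lambda>\<omega>. W \<omega> ^ k) = (\<integral>x. x ^ k \<partial>distr M borel W)" for k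
    by (simp add: integral_distr)
  from law consider \<mu> where "distr M borel W = return borel \<mu>"
    | \<mu> \<sigma> where "\<sigma> > 0" "distr M borel W = density lborel (\<lambda>x. ennreal (normal_density \<mu> \<sigma> x))"
    unfolding normal_law_def by blast
  then have "integrable M (\<lambda>\<omega>. W \<omega> ^ k) \<and>
    expectation (\<lambda>\<omega>. W \<omega> ^ 4) = 3 * (expectation (\<lambda>\<omega>. (W \<omega>)\<^sup>2))\<^sup>2"
  proof cases
    case 1
    then have "\<mu> = 0"
      using mean' by (simp add: integral_return)
    have "integrable (return borel \<mu>) (\<lambda>x. x ^ k)"
      by (rule integrableI_bounded) (simp_all add: nn_integral_return)
    then show ?thesis
      unfolding int_iff expect_eq 1 by (simp add: integral_return \<open>\<mu> = 0\<close>)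
  next
    case 2
    have "\<mu> = 0"
      using mean' integral_normal_moment_nz_1[OF \<open>\<sigma> > 0\<close>, of \<mu>]
      by (simp add: 2 integral_density)
    \<comment> \<open>The even moments of a centred normal law are (2k)! \<sigma>^(2k) / (2^k k!);
      here k = 1 and k = 2.\<close>
    have "(\<integral>x. normal_density 0 \<sigma> x * x\<^sup>2 \<partial>lborel) = \<sigma>\<^sup>2"
      "(\<integral>x. normal_density 0 \<sigma> x * x ^ 4 \<partial>lborel) = 3 * (\<sigma>\<^sup>2)\<^sup>2"
      using integral_normal_moment_even[OF \<open>\<sigma> > 0\<close>, of 0 1]
        integral_normal_moment_even[OF \<open>\<sigma> > 0\<close>, of 0 2]
      by (simp_all add: fact_numeral power_divide)
    then show ?thesis
      unfolding int_iff expect_eq 2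
      using integrable_normal_moment[OF \<open>\<sigma> > 0\<close>, of \<mu> k]
      by (simp add: \<open>\<mu> = 0\<close> integrable_density integral_density)
  qed
  then show "integrable M (\<lambda>\<omega>. W \<omega> ^ k)"
    and "expectation (\<lambda>\<omega>. W \<omega> ^ 4) = 3 * (expectation (\<lambda>\<omega>. (W \<omega>)\<^sup>2))\<^sup>2"
    by auto
qed

lemma integrable_mult_of_squares:
  fixes Y Z :: "'a \<Rightarrow> real"
  assumes [measurable]: "Y \<in> borel_measurable M" "Z \<in> borel_measurable M"
    and "integrable M (\<lambda>\<omega>. (Y \<omega>)\<^sup>2)" "integrable M (\<lambda>\<omega>. (Z \<omega>)\<^sup>2)"
  shows "integrable M (\<lambda>\<omega>. Y \<omega> * Z \<omega>)"
proof (rule Bochner_Integration.integrable_bound)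
  show "integrable M (\<lambda>\<omega>. (Y \<omega>)\<^sup>2 + (Z \<omega>)\<^sup>2)"
    using assms by simp
  have "\<bar>y * z\<bar> \<le> y\<^sup>2 + z\<^sup>2" for y z :: real
    using sum_squares_bound[of "\<bar>y\<bar>" "\<bar>z\<bar>"] abs_ge_zero[of "y * z"]
    unfolding abs_mult power2_abs by linarith
  then show "AE \<omega> in M. norm (Y \<omega> * Z \<omega>) \<le> norm ((Y \<omega>)\<^sup>2 + (Z \<omega>)\<^sup>2)"
    by (auto simp: abs_of_nonneg)
qed simp

text \<open>This is the Isserlis (Wick) formula for the four factors Y, Y, Z, Z. The centred
  Gaussian variables in the polarization have fourth moments equal to three times their squared
  variances, so everything reduces to the second moments of the pair.\<close>

lemma expectation_mult_squares_gaussian: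
  assumes [measurable]: "Y \<in> borel_measurable M" "Z \<in> borel_measurable M"
    and law: "\<And>a b. normal_law (distr M borel (\<lambda>\<omega>. a * Y \<omega> + b * Z \<omega>))"
    and mean: "expectation Y = 0" "expectation Z = 0"
  shows "expectation (\<lambda>\<omega>. (Y \<omega>)\<^sup>2 * (Z \<omega>)\<^sup>2) =
    expectation (\<lambda>\<omega>. (Y \<omega>)\<^sup>2) * expectation (\<lambda>\<omega>. (Z \<omega>)\<^sup>2) + 2 * (expectation (\<lambda>\<omega>. Y \<omega> * Z \<omega>))\<^sup>2"
proof -
  have lawY: "normal_law (distr M borel Y)" and lawZ: "normal_law (distr M borel Z)"
    using law[of 1 0] law[of 0 1] by simp_all
  note momY = normal_law_centered_moments[OF assms(1) lawY mean(1)]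
  note momZ = normal_law_centered_moments[OF assms(2) lawZ mean(2)]
  have int [simp]: "integrable M Y" "integrable M Z"
    "integrable M (\<lambda>\<omega>. (Y \<omega>)\<^sup>2)" "integrable M (\<lambda>\<omega>. (Z \<omega>)\<^sup>2)"
    "integrable M (\<lambda>\<omega>. Y \<omega> ^ 4)" "integrable M (\<lambda>\<omega>. Z \<omega> ^ 4)"
    using momY(1)[of 1] momY(1)[of 2] momY(1)[of 4] momZ(1)[of 1] momZ(1)[of 2] momZ(1)[of 4]
    by simp_all
  have int_YZ [simp]: "integrable M (\<lambda>\<omega>. Y \<omega> * Z \<omega>)"
    by (rule integrable_mult_of_squares) simp_all
  \<comment> \<open>The coefficient \<open>b\<close> covers the sum (\<open>b\<close> = 1) and the
    difference (\<open>b\<close> = -1) at once.\<close>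
  have comb: "integrable M (\<lambda>\<omega>. (Y \<omega> + b * Z \<omega>) ^ 4)"
    "expectation (\<lambda>\<omega>. (Y \<omega> + b * Z \<omega>) ^ 4) =
      3 * (expectation (\<lambda>\<omega>. (Y \<omega>)\<^sup>2) + b\<^sup>2 * expectation (\<lambda>\<omega>. (Z \<omega>)\<^sup>2)
        + 2 * b * expectation (\<lambda>\<omega>. Y \<omega> * Z \<omega>))\<^sup>2" for b
  proof -
    have m: "(\<lambda>\<omega>. Y \<omega> + b * Z \<omega>) \<in> borel_measurable M"
      by measurable
    have l: "normal_law (distr M borel (\<lambda>\<omega>. Y \<omega> + b * Z \<omega>))"
      using law[of 1 b] by simp
    have e: "expectation (\<lambda>\<omega>. Y \<omega> + b * Z \<omega>) = 0"
      using mean by simp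
    have "expectation (\<lambda>\<omega>. (Y \<omega> + b * Z \<omega>)\<^sup>2) =
      expectation (\<lambda>\<omega>. (Y \<omega>)\<^sup>2 + b\<^sup>2 * (Z \<omega>)\<^sup>2 + 2 * b * (Y \<omega> * Z \<omega>))"
      by (simp add: power2_sum power_mult_distrib mult_ac)
    also have "\<dots> = expectation (\<lambda>\<omega>. (Y \<omega>)\<^sup>2) + b\<^sup>2 * expectation (\<lambda>\<omega>. (Z \<omega>)\<^sup>2)
        + 2 * b * expectation (\<lambda>\<omega>. Y \<omega> * Z \<omega>)"
      by simp
    finally show "integrable M (\<lambda>\<omega>. (Y \<omega> + b * Z \<omega>) ^ 4)"
      "expectation (\<lambda>\<omega>. (Y \<omega> + b * Z \<omega>) ^ 4) =
      3 * (expectation (\<lambda>\<omega>. (Y \<omega>)\<^sup>2) + b\<^sup>2 * expectation (\<lambda>\<omega>. (Z \<omega>)\<^sup>2)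
        + 2 * b * expectation (\<lambda>\<omega>. Y \<omega> * Z \<omega>))\<^sup>2"
      using normal_law_centered_moments[OF m l e] by simp_all
  qed
  \<comment> \<open>In the sum of the two fourth powers the odd terms cancel, and each power
    contributes 6 Y^2 Z^2; hence the 12. The factors \<open>1\<close> and \<open>- 1\<close> are
    spelled out to match \<open>comb\<close>.\<close>
  have polarize: "(Y \<omega>)\<^sup>2 * (Z \<omega>)\<^sup>2 = (1 / 12) *
    ((Y \<omega> + 1 * Z \<omega>) ^ 4 + (Y \<omega> + (- 1) * Z \<omega>) ^ 4 - 2 * Y \<omega> ^ 4 - 2 * Z \<omega> ^ 4)" for \<omega>
    by (simp add: power2_eq_square power4_eq_xxxx algebra_simps)
  have "expectation (\<lambda>\<omega>. (Y \<omega>)\<^sup>2 * (Z \<omega>)\<^sup>2) = (1 / 12) *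
    (expectation (\<lambda>\<omega>. (Y \<omega> + 1 * Z \<omega>) ^ 4) + expectation (\<lambda>\<omega>. (Y \<omega> + (- 1) * Z \<omega>) ^ 4)
      - 2 * expectation (\<lambda>\<omega>. Y \<omega> ^ 4) - 2 * expectation (\<lambda>\<omega>. Z \<omega> ^ 4))"
    unfolding polarize using comb(1)[of 1] comb(1)[of "- 1"] by simp
  then show ?thesis
    unfolding comb(2) momY(2) momZ(2) by (simp add: power2_eq_square algebra_simps)
qed

text \<open>Subtracting E[Y^2] E[Z^2] removes exactly the product of variances in the Isserlis
  formula.\<close>

lemma covariance_squares_gaussian:
  assumes "Y \<in> borel_measurable M" "Z \<in> borel_measurable M"
    and law: "\<And>a b. normal_law (distr M borel (\<lambda>\<omega>. a * Y \<omega> + b * Z \<omega>))"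
    and mean: "expectation Y = 0" "expectation Z = 0"
  shows "covariance M (\<lambda>\<omega>. (Y \<omega>)\<^sup>2) (\<lambda>\<omega>. (Z \<omega>)\<^sup>2) = 2 * (covariance M Y Z)\<^sup>2"
proof -
  have lawY: "normal_law (distr M borel Y)" and lawZ: "normal_law (distr M borel Z)"
    using law[of 1 0] law[of 0 1] by simp_all
  note momY = normal_law_centered_moments[OF assms(1) lawY mean(1)]
  note momZ = normal_law_centered_moments[OF assms(2) lawZ mean(2)]
  have [simp]: "integrable M (\<lambda>\<omega>. (Y \<omega>)\<^sup>2)" "integrable M (\<lambda>\<omega>. (Z \<omega>)\<^sup>2)"
    using momY(1)[of 2] momZ(1)[of 2] .
  \<comment> \<open>The product bound is applied to Y^2 and Z^2, whose squares are the integrable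
    fourth powers.\<close>
  have [simp]: "integrable M (\<lambda>\<omega>. (Y \<omega>)\<^sup>2 * (Z \<omega>)\<^sup>2)"
    using momY(1)[of 4] momZ(1)[of 4] assms(1,2)
    by (intro integrable_mult_of_squares) (simp_all flip: power_mult)
  define v w where "v = expectation (\<lambda>\<omega>. (Y \<omega>)\<^sup>2)" and "w = expectation (\<lambda>\<omega>. (Z \<omega>)\<^sup>2)"
  have "covariance M (\<lambda>\<omega>. (Y \<omega>)\<^sup>2) (\<lambda>\<omega>. (Z \<omega>)\<^sup>2) =
    expectation (\<lambda>\<omega>. (Y \<omega>)\<^sup>2 * (Z \<omega>)\<^sup>2 - w * (Y \<omega>)\<^sup>2 - v * (Z \<omega>)\<^sup>2 + v * w)"
    unfolding covariance_def v_def[symmetric] w_def[symmetric] by (simp add: algebra_simps)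
  also have "\<dots> = expectation (\<lambda>\<omega>. (Y \<omega>)\<^sup>2 * (Z \<omega>)\<^sup>2) - v * w"
    by (simp add: v_def[symmetric] w_def[symmetric] prob_space)
  also have "\<dots> = 2 * (expectation (\<lambda>\<omega>. Y \<omega> * Z \<omega>))\<^sup>2"
    unfolding expectation_mult_squares_gaussian[OF assms] by (simp add: v_def w_def)
  finally show ?thesis
    by (simp add: covariance_def mean)
qed

text \<open>With Z = Y the covariance formula also gives Var(Y^2) = 2 (Var Y)^2, so the factors 2 in
  numerator and denominator cancel. If a variance vanishes, both sides are 0 by division by
  0.\<close>

lemma correlation_squares_gaussian:
  assumes "Y \<in> borel_measurable M" "Z \<in> borel_measurable M"
    and law: "\<And>a b. normal_law (distr M borel (\<lambda>\<omega>. a * Y \<omega> + b * Z \<omega>))"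
    and mean: "expectation Y = 0" "expectation Z = 0"
  shows "correlation M (\<lambda>\<omega>. (Y \<omega>)\<^sup>2) (\<lambda>\<omega>. (Z \<omega>)\<^sup>2) = (correlation M Y Z)\<^sup>2"
proof -
  \<comment> \<open>The pairs (Y, Y) and (Z, Z) are jointly Gaussian as well, which allows the
    covariance formula to compute the variances of the squares.\<close>
  have degenerate: "normal_law (distr M borel (\<lambda>\<omega>. a * Y \<omega> + b * Y \<omega>))"
    "normal_law (distr M borel (\<lambda>\<omega>. a * Z \<omega> + b * Z \<omega>))" for a b
    using law[of "a + b" 0] law[of 0 "a + b"] by (simp_all add: distrib_right)
  have nonneg: "0 \<le> covariance M W W" for W
    by (simp add: covariance_def)
  have "sqrt (2 * v\<^sup>2) * sqrt (2 * w\<^sup>2) = (sqrt 2 * sqrt 2) * (v * w)" if "0 \<le> v" "0 \<le> w" for v w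
    using that by (simp add: real_sqrt_mult del: real_sqrt_mult_self)
  then have sqrt_eq: "sqrt (2 * v\<^sup>2) * sqrt (2 * w\<^sup>2) = 2 * (v * w)" if "0 \<le> v" "0 \<le> w" for v w
    using that by simp
  show ?thesis
    using covariance_squares_gaussian[OF assms]
      covariance_squares_gaussian[OF assms(1,1) degenerate(1) mean(1,1)]
      covariance_squares_gaussian[OF assms(2,2) degenerate(2) mean(2,2)]
      nonneg[of Y] nonneg[of Z]
    by (simp add: correlation_def sqrt_eq power_divide power_mult_distrib)
qed

text \<open>The definition sums over a set of times, so no time can occur twice. Here
  \<open>f\<close> may repeat times: \<open>c\<close> collects the coefficients belonging to the
  same time.\<close>

lemma gaussian_process_sum:
  assumes "gaussian_process M T X" "finite I" "f ` I \<subseteq> T"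
  shows "normal_law (distr M borel (\<lambda>\<omega>. \<Sum>i\<in>I. a i * X (f i) \<omega>))"
proof -
  define c where "c = (\<lambda>r. \<Sum>i | i \<in> I \<and> f i = r. a i)"
  have "(\<Sum>i\<in>I. a i * X (f i) \<omega>) = (\<Sum>r\<in>f ` I. c r * X r \<omega>)" for \<omega>
    unfolding sum.image_gen[OF \<open>finite I\<close>, of _ f] c_def sum_distrib_right
    by (intro sum.cong) auto
  then show ?thesis
    using assms unfolding gaussian_process_def by simp
qed

end

section \<open>Covariances and correlations of the increments\<close>

context gmsi_process
begin

lemma time_intervalI: "0 \<le> r \<Longrightarrow> r \<le> r' \<Longrightarrow> ereal r' < \<Delta> \<Longrightarrow> r \<in> time_interval \<Delta>"
  unfolding time_interval_def by (auto intro: le_less_trans[of "ereal r" "ereal r'"])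

lemma measurable_X: "r \<in> time_interval \<Delta> \<Longrightarrow> X r \<in> borel_measurable M"
  using gaussian unfolding gaussian_process_def by blast

lemma integrable_X_power:
  assumes "r \<in> time_interval \<Delta>"
  shows "integrable M (\<lambda>\<omega>. X r \<omega> ^ k)"
  using normal_law_centered_moments(1)[OF measurable_X _ zero_mean, OF assms _ assms]
    gaussian_process_sum[OF gaussian, of "{r}" "\<lambda>i. i" "\<lambda>_. 1"] assms
  by simp

lemma integrable_X: "r \<in> time_interval \<Delta> \<Longrightarrow> integrable M (X r)"
  using integrable_X_power[of r 1] by simp

lemma integrable_X_mult:
  "r \<in> time_interval \<Delta> \<Longrightarrow> r' \<in> time_interval \<Delta> \<Longrightarrow> integrable M (\<lambda>\<omega>. X r \<omega> * X r' \<omega>)"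
  by (intro integrable_mult_of_squares measurable_X integrable_X_power)

text \<open>For a finite end point D, 2 s \<tau> is at most 2 s \<theta> / D, which is below
  \<theta> since 2 s < D; for an infinite one \<tau> is at most 0. The bound makes \<theta> - s
  \<tau> positive and keeps the correlation in [-1, 1].\<close>

lemma s_tau_less_half_theta:
  assumes "0 \<le> s" "ereal (2 * s) < \<Delta>"
  shows "2 * (s * \<tau>) < \<theta>"
proof (cases \<Delta>)
  case (real D)
  then have "0 < D" "\<tau> \<le> \<theta> / D" "2 * s < D"
    using Delta_pos tau_le assms by simp_all
  then have "2 * s * \<tau> \<le> 2 * s * (\<theta> / D)"
    using assms(1) by (intro mult_left_mono) auto
  also have "\<dots> < D * (\<theta> / D)"
    using \<open>0 < D\<close> \<open>2 * s < D\<close> theta_pos by (intro mult_strict_right_mono) auto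
  finally show ?thesis
    using \<open>0 < D\<close> by simp
next
  case PInf
  then have "\<tau> \<le> 0"
    using tau_le by (simp add: zero_ereal_def)
  then show ?thesis
    using mult_nonneg_nonpos[OF assms(1)] theta_pos by fastforce
qed (use Delta_pos in auto)

lemma measurable_increment:
  assumes "0 \<le> t" "0 \<le> s" "ereal (t + s) < \<Delta>"
  shows "increment X s t \<in> borel_measurable M"
proof -
  have [measurable]: "X t \<in> borel_measurable M" "X (t + s) \<in> borel_measurable M"
    using assms by (auto intro!: measurable_X time_intervalI[of _ "t + s"])
  show ?thesis
    unfolding increment_def by measurable
qed

lemma expectation_increment:
  assumes "0 \<le> t" "0 \<le> s" "ereal (t + s) < \<Delta>"
  shows "expectation (increment X s t) = 0"
proof -
  have "t \<in> time_interval \<Delta>" "t + s \<in> time_interval \<Delta>"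
    using assms by (auto intro!: time_intervalI[of _ "t + s"])
  then show ?thesis
    unfolding increment_def by (simp add: integrable_X zero_mean)
qed

text \<open>After expansion the \<theta>-terms leave s and the \<tau>-terms leave the square of (t +
  s) - t, so t drops out.\<close>

lemma covariance_increment_same:
  assumes "0 \<le> t" "0 \<le> s" "ereal (t + s) < \<Delta>"
  shows "covariance M (increment X s t) (increment X s t) = s * (\<theta> - s * \<tau>)"
proof -
  have T: "t \<in> time_interval \<Delta>" "t + s \<in> time_interval \<Delta>"
    using assms by (auto intro!: time_intervalI[of _ "t + s"])
  then have "ereal t < \<Delta>"
    by (simp add: time_interval_def)
  have "covariance M (increment X s t) (increment X s t) =
    expectation (\<lambda>\<omega>. X (t + s) \<omega> * X (t + s) \<omega> - 2 * (X t \<omega> * X (t + s) \<omega>) + X t \<omega> * X t \<omega>)"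
    unfolding covariance_def expectation_increment[OF assms]
    by (simp add: increment_def algebra_simps)
  also have "\<dots> = expectation (\<lambda>\<omega>. X (t + s) \<omega> * X (t + s) \<omega>)
      - 2 * expectation (\<lambda>\<omega>. X t \<omega> * X (t + s) \<omega>) + expectation (\<lambda>\<omega>. X t \<omega> * X t \<omega>)"
    by (simp add: integrable_X_mult T)
  also have "\<dots> = s * (\<theta> - s * \<tau>)"
    using assms \<open>ereal t < \<Delta>\<close> by (simp add: cov) (simp add: algebra_simps)
  finally show ?thesis .
qed

text \<open>Since s \<le> u, the times of the first increment precede those of the second, so
  \<open>cov\<close> applies to all four products. The \<theta>-terms cancel, and the \<tau>-terms
  factor into ((t + s) - t) ((t + u + s) - (t + u)).\<close>

lemma covariance_increments:
  assumes "0 \<le> t" "0 \<le> s" "s \<le> u" "ereal (t + u + s) < \<Delta>"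
  shows "covariance M (increment X s t) (increment X s (t + u)) = - (s\<^sup>2 * \<tau>)"
proof -
  have T: "t \<in> time_interval \<Delta>" "t + s \<in> time_interval \<Delta>" "t + u \<in> time_interval \<Delta>"
    "t + u + s \<in> time_interval \<Delta>"
    using assms by (auto intro!: time_intervalI[of _ "t + u + s"])
  then have less: "ereal t < \<Delta>" "ereal (t + s) < \<Delta>" "ereal (t + u) < \<Delta>"
    by (simp_all add: time_interval_def)
  have mean: "expectation (increment X s t) = 0" "expectation (increment X s (t + u)) = 0"
    using assms less by (auto intro!: expectation_increment)
  have "covariance M (increment X s t) (increment X s (t + u)) =
    expectation (\<lambda>\<omega>. X (t + s) \<omega> * X (t + u + s) \<omega> - X (t + s) \<omega> * X (t + u) \<omega>
      - X t \<omega> * X (t + u + s) \<omega> + X t \<omega> * X (t + u) \<omega>)"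
    unfolding covariance_def mean by (simp add: increment_def algebra_simps)
  also have "\<dots> = expectation (\<lambda>\<omega>. X (t + s) \<omega> * X (t + u + s) \<omega>)
      - expectation (\<lambda>\<omega>. X (t + s) \<omega> * X (t + u) \<omega>)
      - expectation (\<lambda>\<omega>. X t \<omega> * X (t + u + s) \<omega>) + expectation (\<lambda>\<omega>. X t \<omega> * X (t + u) \<omega>)"
    by (simp add: integrable_X_mult T)
  also have "\<dots> = - (s\<^sup>2 * \<tau>)"
    using assms less by (simp add: cov) (simp add: power2_eq_square algebra_simps)
  finally show ?thesis .
qed

lemma correlation_increments:
  assumes "0 \<le> t" "0 \<le> s" "s \<le> u" "ereal (t + u + s) < \<Delta>"
  shows "correlation M (increment X s t) (increment X s (t + u)) = - s * \<tau> / (\<theta> - s * \<tau>)"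
proof -
  have "t + s \<in> time_interval \<Delta>"
    using assms by (auto intro!: time_intervalI[of _ "t + u + s"])
  then have less: "ereal (t + s) < \<Delta>"
    by (simp add: time_interval_def)
  \<comment> \<open>From t \<ge> 0 and s \<le> u it follows that 2 s \<le> t + u + s.\<close>
  have "2 * s \<in> time_interval \<Delta>"
    using assms by (auto intro!: time_intervalI[of _ "t + u + s"])
  then have "2 * (s * \<tau>) < \<theta>"
    using s_tau_less_half_theta assms by (simp add: time_interval_def)
  then have pos: "0 < \<theta> - s * \<tau>"
    using theta_pos by linarith
  then have "correlation M (increment X s t) (increment X s (t + u)) =
    - (s\<^sup>2 * \<tau>) / (s * (\<theta> - s * \<tau>))"
    unfolding correlation_def using assms less
    by (simp add: covariance_increments covariance_increment_same)
  also have "\<dots> = - s * \<tau> / (\<theta> - s * \<tau>)"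
    \<comment> \<open>For s = 0 the left side is 0 / 0 = 0, which agrees with the right side;
      otherwise one factor s cancels.\<close>
    using pos by (cases "s = 0") (simp_all add: power2_eq_square field_simps)
  finally show ?thesis .
qed

lemma correlation_squared_increments:
  assumes "0 \<le> t" "0 \<le> s" "s \<le> u" "ereal (t + u + s) < \<Delta>"
  shows "correlation M (\<lambda>\<omega>. (increment X s t \<omega>)\<^sup>2) (\<lambda>\<omega>. (increment X s (t + u) \<omega>)\<^sup>2) =
    (correlation M (increment X s t) (increment X s (t + u)))\<^sup>2"
proof (rule correlation_squares_gaussian)
  have T: "t \<in> time_interval \<Delta>" "t + s \<in> time_interval \<Delta>" "t + u \<in> time_interval \<Delta>"
    "t + u + s \<in> time_interval \<Delta>"
    using assms by (auto intro!: time_intervalI[of _ "t + u + s"])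
  then have less: "ereal (t + s) < \<Delta>"
    by (simp add: time_interval_def)
  show "increment X s t \<in> borel_measurable M" "increment X s (t + u) \<in> borel_measurable M"
    "expectation (increment X s t) = 0" "expectation (increment X s (t + u)) = 0"
    using assms less by (auto intro!: measurable_increment expectation_increment)
  fix a b :: real
  \<comment> \<open>A combination of the two increments is one of four values of X. They are indexed
    by list positions rather than by times, because times can coincide, for instance t + s and t + u
    when s = u.\<close>
  have "(\<lambda>\<omega>. a * increment X s t \<omega> + b * increment X s (t + u) \<omega>) =
    (\<lambda>\<omega>. \<Sum>i<4. [a, - a, b, - b] ! i * X ([t + s, t, t + u + s, t + u] ! i) \<omega>)"
    by (simp add: increment_def eval_nat_numeral algebra_simps)
  moreover have "(!) [t + s, t, t + u + s, t + u] ` {..<4} \<subseteq> time_interval \<Delta>"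
    using T by (auto simp: eval_nat_numeral less_Suc_eq)
  ultimately show "normal_law (distr M borel
      (\<lambda>\<omega>. a * increment X s t \<omega> + b * increment X s (t + u) \<omega>))"
    using gaussian_process_sum[OF gaussian, of "{..<4}" "(!) [t + s, t, t + u + s, t + u]"
        "(!) [a, - a, b, - b]"] by (simp only: finite_lessThan)
qed

text \<open>By the explicit formula the claim is that |s \<tau>| is at most \<theta> - s \<tau>. For
  \<tau> \<ge> 0 this is 2 s \<tau> \<le> \<theta>; for \<tau> < 0 it is 0 \<le> \<theta>.\<close>

lemma abs_correlation_increments_le_1:
  assumes "0 \<le> t" "0 \<le> s" "s \<le> u" "ereal (t + u + s) < \<Delta>"
  shows "\<bar>correlation M (increment X s t) (increment X s (t + u))\<bar> \<le> 1"
proof -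
  have "2 * s \<in> time_interval \<Delta>"
    using assms by (auto intro!: time_intervalI[of _ "t + u + s"])
  then have "2 * (s * \<tau>) < \<theta>"
    using s_tau_less_half_theta assms by (simp add: time_interval_def)
  then show ?thesis
    unfolding correlation_increments[OF assms] using theta_pos
    by (simp add: abs_le_iff field_simps)
qed

end

section \<open>Limits of the correlation along families of processes\<close>

lemma correlation_tendsto_at_bot:
  fixes N :: "real \<Rightarrow> 'b measure"
  assumes gmsi: "\<And>\<sigma>. ereal \<sigma> \<le> ereal \<theta> / \<Delta> \<Longrightarrow> gmsi_process (N \<sigma>) (Y \<sigma>) \<theta> \<sigma> \<Delta>"
    and "0 < \<theta>" "0 < \<Delta>" "0 \<le> t" "0 < s" "s \<le> u" "ereal (t + u + s) < \<Delta>"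
  shows "((\<lambda>\<sigma>. correlation (N \<sigma>) (increment (Y \<sigma>) s t) (increment (Y \<sigma>) s (t + u)))
    \<longlongrightarrow> 1) at_bot"
proof -
  \<comment> \<open>Every \<sigma> \<le> 0 is therefore admissible, so the correlation formula holds
    eventually at \<open>at_bot\<close>.\<close>
  have nonneg: "0 \<le> ereal \<theta> / \<Delta>"
    using assms by (cases \<Delta>) auto
  have "\<forall>\<^sub>F \<sigma> in at_bot. - s * \<sigma> / (\<theta> - s * \<sigma>) =
    correlation (N \<sigma>) (increment (Y \<sigma>) s t) (increment (Y \<sigma>) s (t + u))"
    using eventually_le_at_bot[of "0 :: real"]
  proof eventually_elim
    case (elim \<sigma>)
    with nonneg have "ereal \<sigma> \<le> ereal \<theta> / \<Delta>"
      by (auto intro: order_trans[of "ereal \<sigma>" 0 "ereal \<theta> / \<Delta>"])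
    from gmsi_process.correlation_increments[OF gmsi[OF this], of t s u] assms
    show ?case by simp
  qed
  moreover have "((\<lambda>\<sigma>. - s * \<sigma> / (\<theta> - s * \<sigma>)) \<longlongrightarrow> 1) at_bot"
    using \<open>0 < s\<close> by real_asymp
  ultimately show ?thesis
    by (rule Lim_transform_eventually[rotated])
qed

lemma correlation_tendsto_joint_limit:
  fixes N :: "real \<Rightarrow> 'b measure"
  assumes gmsi: "\<And>\<sigma>. \<sigma> \<le> \<theta> / D \<Longrightarrow> gmsi_process (N \<sigma>) (Y \<sigma>) \<theta> \<sigma> (ereal D)"
    and "0 < \<theta>" "0 < D"
  shows "((\<lambda>(\<sigma>, r, a, b).
      correlation (N \<sigma>) (increment (Y \<sigma>) r a) (increment (Y \<sigma>) r (a + b)))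
    \<longlongrightarrow> - 1) (joint_limit \<theta> D)"
proof -
  \<comment> \<open>The correlation depends on (\<sigma>, r) alone: on the admissible set
    \<open>A\<close> it equals \<open>g\<close> composed with the projection \<open>p\<close>, which
    makes the limit uniform in the other two coordinates.\<close>
  define g where "g = (\<lambda>(\<sigma>, r). - r * \<sigma> / (\<theta> - r * \<sigma>))"
  define p :: "real \<times> real \<times> real \<times> real \<Rightarrow> real \<times> real" where "p = (\<lambda>(\<sigma>, r, a, b). (\<sigma>, r))"
  define A where "A = {(\<sigma>, r, a, b). \<sigma> \<le> \<theta> / D \<and> 0 \<le> a \<and> 0 \<le> r \<and> r \<le> b \<and> a + b + r < D}"
  have jl: "joint_limit \<theta> D = inf (filtercomap p (nhds (\<theta> / D, D / 2))) (principal A)"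
    unfolding joint_limit_def p_def A_def ..
  \<comment> \<open>At this point r \<sigma> = \<theta> / 2, so the denominator is \<theta> / 2,
    which is nonzero, and the value of \<open>g\<close> is -1.\<close>
  have "isCont g (\<theta> / D, D / 2)"
    unfolding g_def case_prod_beta using assms by (intro continuous_intros) auto
  then have "(g \<longlongrightarrow> g (\<theta> / D, D / 2)) (nhds (\<theta> / D, D / 2))"
    by (simp add: continuous_at tendsto_at_iff_tendsto_nhds)
  moreover have "g (\<theta> / D, D / 2) = - 1"
    using assms by (simp add: g_def)
  ultimately have lim: "(g \<longlongrightarrow> - 1) (nhds (\<theta> / D, D / 2))"
    by simp
  \<comment> \<open>Without the restriction to \<open>A\<close>, the filter is by construction the
    pullback of the neighbourhoods along \<open>p\<close>; the restriction only makes it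
    finer.\<close>
  have "filterlim p (nhds (\<theta> / D, D / 2)) (joint_limit \<theta> D)"
    unfolding jl by (rule filterlim_mono[OF filterlim_filtercomap order_refl inf_le1])
  from filterlim_compose[OF lim this]
  have "((\<lambda>x. g (p x)) \<longlongrightarrow> - 1) (joint_limit \<theta> D)" .
  moreover have "\<forall>\<^sub>F x in joint_limit \<theta> D. x \<in> A"
    unfolding jl by (simp add: eventually_inf_principal)
  then have "\<forall>\<^sub>F x in joint_limit \<theta> D. g (p x) = (\<lambda>(\<sigma>, r, a, b).
      correlation (N \<sigma>) (increment (Y \<sigma>) r a) (increment (Y \<sigma>) r (a + b))) x"
  proof eventually_elim
    case (elim x)
    obtain \<sigma> r a b where x: "x = (\<sigma>, r, a, b)"
      by (metis prod_cases4)
    with elim gmsi_process.correlation_increments[OF gmsi, of \<sigma> a r b]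
    show ?case by (simp add: A_def g_def p_def)
  qed
  ultimately show ?thesis
    by (rule Lim_transform_eventually)
qed

theorem corollary2:
  fixes M :: "'a measure" and X :: "real \<Rightarrow> 'a \<Rightarrow> real"
    and \<theta> \<tau> s t u :: real and \<Delta> :: ereal
  assumes "gmsi_process M X \<theta> \<tau> \<Delta>"
    and "0 \<le> t" and "0 \<le> s" and "s \<le> u" and "ereal (t + u + s) < \<Delta>"
  shows "correlation M (increment X s t) (increment X s (t + u)) = - s * \<tau> / (\<theta> - s * \<tau>)
    \<and> correlation M (\<lambda>\<omega>. (increment X s t \<omega>)\<^sup>2) (\<lambda>\<omega>. (increment X s (t + u) \<omega>)\<^sup>2)
        = s\<^sup>2 * \<tau>\<^sup>2 / (\<theta> - s * \<tau>)\<^sup>2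
    \<and> (\<forall>(N :: real \<Rightarrow> 'b measure) Y.
        (\<forall>\<sigma>. ereal \<sigma> \<le> ereal \<theta> / \<Delta> \<longrightarrow> gmsi_process (N \<sigma>) (Y \<sigma>) \<theta> \<sigma> \<Delta>) \<longrightarrow>
        (0 < s \<longrightarrow>
          ((\<lambda>\<sigma>. correlation (N \<sigma>) (increment (Y \<sigma>) s t) (increment (Y \<sigma>) s (t + u)))
            \<longlongrightarrow> 1) at_bot)
        \<and> (\<forall>D. \<Delta> = ereal D \<longrightarrow>
          ((\<lambda>(\<sigma>, r, a, b).
              correlation (N \<sigma>) (increment (Y \<sigma>) r a) (increment (Y \<sigma>) r (a + b)))
            \<longlongrightarrow> - 1) (joint_limit \<theta> D)))
    \<and> (correlation M (increment X s t) (increment X s (t + u)))\<^sup>2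
        \<le> correlation M (\<lambda>\<omega>. (increment X s t \<omega>)\<^sup>2) (\<lambda>\<omega>. (increment X s (t + u) \<omega>)\<^sup>2)
    \<and> correlation M (\<lambda>\<omega>. (increment X s t \<omega>)\<^sup>2) (\<lambda>\<omega>. (increment X s (t + u) \<omega>)\<^sup>2)
        \<le> \<bar>correlation M (increment X s t) (increment X s (t + u))\<bar>"
proof -
  interpret gmsi_process M X \<theta> \<tau> \<Delta>
    by fact
  define \<rho> where "\<rho> = correlation M (increment X s t) (increment X s (t + u))"
  have \<rho>: "\<rho> = - s * \<tau> / (\<theta> - s * \<tau>)"
    and square: "correlation M (\<lambda>\<omega>. (increment X s t \<omega>)\<^sup>2) (\<lambda>\<omega>. (increment X s (t + u) \<omega>)\<^sup>2) = \<rho>\<^sup>2"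
    and "\<bar>\<rho>\<bar> \<le> 1"
    unfolding \<rho>_def using assms(2-5)
    by (intro correlation_increments correlation_squared_increments
        abs_correlation_increments_le_1; simp)+
  have "\<rho>\<^sup>2 = s\<^sup>2 * \<tau>\<^sup>2 / (\<theta> - s * \<tau>)\<^sup>2"
    unfolding \<rho> by (simp add: power_divide power_mult_distrib)
  \<comment> \<open>Multiplying |\<rho>| \<le> 1 by |\<rho>| gives the upper bound. The lower bound
    in the theorem is an equality by \<open>square\<close>.\<close>
  moreover have "\<rho>\<^sup>2 \<le> \<bar>\<rho>\<bar>"
    using mult_left_mono[OF \<open>\<bar>\<rho>\<bar> \<le> 1\<close>, of "\<bar>\<rho>\<bar>"] by (simp add: power2_eq_square)
  moreover have "(0 < s \<longrightarrow>
          ((\<lambda>\<sigma>. correlation (N \<sigma>) (increment (Y \<sigma>) s t) (increment (Y \<sigma>) s (t + u)))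
            \<longlongrightarrow> 1) at_bot)
        \<and> (\<forall>D. \<Delta> = ereal D \<longrightarrow>
          ((\<lambda>(\<sigma>, r, a, b).
              correlation (N \<sigma>) (increment (Y \<sigma>) r a) (increment (Y \<sigma>) r (a + b)))
            \<longlongrightarrow> - 1) (joint_limit \<theta> D))"
    if gmsi: "\<forall>\<sigma>. ereal \<sigma> \<le> ereal \<theta> / \<Delta> \<longrightarrow> gmsi_process (N \<sigma>) (Y \<sigma>) \<theta> \<sigma> \<Delta>"
    for N :: "real \<Rightarrow> 'b measure" and Y
  proof (intro conjI impI allI)
    assume "0 < s"
    then show "((\<lambda>\<sigma>. correlation (N \<sigma>) (increment (Y \<sigma>) s t) (increment (Y \<sigma>) s (t + u)))
            \<longlongrightarrow> 1) at_bot"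
      using gmsi assms theta_pos Delta_pos
      by (intro correlation_tendsto_at_bot[where \<theta> = \<theta> and \<Delta> = \<Delta>]) auto
  next
    fix D assume "\<Delta> = ereal D"
    then show "((\<lambda>(\<sigma>, r, a, b).
              correlation (N \<sigma>) (increment (Y \<sigma>) r a) (increment (Y \<sigma>) r (a + b)))
            \<longlongrightarrow> - 1) (joint_limit \<theta> D)"
      using gmsi theta_pos Delta_pos
      by (intro correlation_tendsto_joint_limit) auto
  qed
  ultimately show ?thesis
    unfolding square unfolding \<rho>_def[symmetric] using \<rho> by blast
qed

end
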